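(* Let $n\ge1$ be fixed, let $p=p(D)\in[0,1]$, let $\mathfrak I\sim\mathcal I(n,D,p)$, and let $r=r(D)$ be a (positive real-valued) function tending to infinity as $D\to\infty$. If $p=\omega(1/r)$, then $\mathrm{reg}_0(\mathfrak I)\le nr$ asymptotically almost surely, i.e. $\lim_{D\to\infty}P(\mathrm{reg}_0(\mathfrak I)\le n\,r(D))=1$.
   Context: Let $k$ be a field and $S=k[x_1,\dots,x_n]$. $\mathcal B(n,D,p)$ is the distribution of the random set $\mathfrak B$ of monomials of $S$ obtained by including each non-constant monomial of total degree at most $D$ independently with probability $p$. $\mathcal I(n,D,p)$ is the distribution of the random monomial ideal $\mathfrak I=(\mathfrak B)$, with $\mathfrak I=(0)$ if $\mathfrak B=\emptyset$. The degree complexity $\mathrm{reg}_0(I)$ of a monomial ideal $I$ is the maximum degree of a minimal generator of $I$ (with $\mathrm{reg}_0((0))=0$). $g=\omega(f)$ means $\lim_{D\to\infty} f/g=0$. *)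

theory Defs
  imports
    "HOL-Library.Poly_Mapping"
    "HOL-Library.Landau_Symbols"
    "HOL-Probability.Probability"
begin

text \<open>
  The polynomial ring \<open>S = k[x\<^sub>1,\<dots>,x\<^sub>n]\<close> is the type of finitely supported maps from
  exponent vectors to coefficients (with the convolution product), the variables being
  indexed by a finite type \<open>'n\<close> with \<open>n = CARD('n)\<close>.
\<close>

type_synonym ('n, 'k) mpoly = "('n \<Rightarrow>\<^sub>0 nat) \<Rightarrow>\<^sub>0 'k"

definition exp_degree :: "('n::finite \<Rightarrow>\<^sub>0 nat) \<Rightarrow> nat" where
  "exp_degree m = (\<Sum>i\<in>UNIV. Poly_Mapping.lookup m i)"

text \<open>Convention: the zero polynomial has total degree 0.\<close>

definition total_degree :: "('n::finite, 'k::zero) mpoly \<Rightarrow> nat" where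
  "total_degree f = Max (insert 0 (exp_degree ` Poly_Mapping.keys f))"

definition monomials :: "('n::finite, 'k::field) mpoly set" where
  "monomials = range (\<lambda>m. Poly_Mapping.single m 1)"

definition nonconst_monomials_upto :: "nat \<Rightarrow> ('n::finite, 'k::field) mpoly set" where
  "nonconst_monomials_upto D = {x \<in> monomials. 1 \<le> total_degree x \<and> total_degree x \<le> D}"

text \<open>The ideal generated by a set, as a submodule of the ring over itself; \<open>ideal {} = {0}\<close>.\<close>

definition ideal :: "'r::comm_ring_1 set \<Rightarrow> 'r set" where
  "ideal B = module.span (*) B"

definition min_generating_set ::
    "('n::finite, 'k::field) mpoly set \<Rightarrow> ('n, 'k) mpoly set \<Rightarrow> bool" where
  "min_generating_set I G \<longleftrightarrow>
     G \<subseteq> monomials \<and> ideal G = I \<and> (\<forall>H. H \<subset> G \<longrightarrow> ideal H \<noteq> I)"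

text \<open>A monomial ideal has exactly one minimal generating set of monomials.\<close>

definition min_generators :: "('n::finite, 'k::field) mpoly set \<Rightarrow> ('n, 'k) mpoly set" where
  "min_generators I = {x. \<exists>G. min_generating_set I G \<and> x \<in> G}"

definition reg0 :: "('n::finite, 'k::field) mpoly set \<Rightarrow> nat" where
  "reg0 I = (if I = {0} then 0 else Max (total_degree ` min_generators I))"

text \<open>
  The distributions \<open>\<B>(n,D,p)\<close> and \<open>\<I>(n,D,p)\<close>: the product of Bernoulli distributions
  gives the indicator function of the random set of monomials.
\<close>

definition random_monomials :: "nat \<Rightarrow> real \<Rightarrow> ('n::finite, 'k::field) mpoly set pmf" where
  "random_monomials D p =
     map_pmf (\<lambda>f. {x \<in> nonconst_monomials_upto D. f x})
       (Pi_pmf (nonconst_monomials_upto D) False (\<lambda>_. bernoulli_pmf p))"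

definition random_monomial_ideal :: "nat \<Rightarrow> real \<Rightarrow> ('n::finite, 'k::field) mpoly set pmf" where
  "random_monomial_ideal D p = map_pmf ideal (random_monomials D p)"

lemma total_degree_single:
  "total_degree (Poly_Mapping.single m (1::'k::field) :: ('n::finite, 'k) mpoly) = exp_degree m"
  by (simp add: total_degree_def)

lemma finite_exp_degree_le: "finite {m :: 'n::finite \<Rightarrow>\<^sub>0 nat. exp_degree m \<le> D}"
proof (rule finite_imageD)
  have "Poly_Mapping.lookup ` {m :: 'n \<Rightarrow>\<^sub>0 nat. exp_degree m \<le> D} \<subseteq> PiE UNIV (\<lambda>_. {..D})"
  proof (clarsimp simp: PiE_UNIV_domain)
    fix m :: "'n \<Rightarrow>\<^sub>0 nat" and i assume "exp_degree m \<le> D"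
    moreover have "Poly_Mapping.lookup m i \<le> exp_degree m"
      unfolding exp_degree_def by (rule member_le_sum) auto
    ultimately show "Poly_Mapping.lookup m i \<le> D" by simp
  qed
  then show "finite (Poly_Mapping.lookup ` {m :: 'n \<Rightarrow>\<^sub>0 nat. exp_degree m \<le> D})"
    by (rule finite_subset) (simp add: finite_PiE)
qed (simp add: inj_on_def poly_mapping_eqI)

text \<open>\<^const>\<open>Pi_pmf\<close> is only meaningful for a finite index set.\<close>

lemma finite_nonconst_monomials_upto:
  "finite (nonconst_monomials_upto D :: ('n::finite, 'k::field) mpoly set)"
proof (rule finite_subset)
  show "(nonconst_monomials_upto D :: ('n, 'k) mpoly set) \<subseteq>
      (\<lambda>m. Poly_Mapping.single m 1) ` {m. exp_degree m \<le> D}"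
    by (auto simp: nonconst_monomials_upto_def monomials_def total_degree_single)
qed (simp add: finite_exp_degree_le)

lemma module_mult: "module ((*) :: 'r::comm_ring_1 \<Rightarrow> 'r \<Rightarrow> 'r)"
  by unfold_locales (auto simp: algebra_simps)

lemma ideal_empty: "ideal ({} :: 'r::comm_ring_1 set) = {0}"
  unfolding ideal_def by (rule module.span_empty[OF module_mult])

end

theory Submission
  imports Defs
begin

text \<open>
  Let \<open>N\<close> be the integer part of \<open>r\<close>. The bound on the degree complexity comes from pure
  powers: if for every variable \<open>x\<^sub>i\<close> the random set contains some power
  \<open>x\<^sub>i\<^sup>a\<close> with \<open>1 \<le> a \<le> N\<close>, then no minimal generator can have an exponent above
  \<open>N\<close>, since it would be a proper multiple of an element of the ideal; so every minimal
  generator has degree at most \<open>n N \<le> n r\<close> (\<open>reg0_le_if_pure_powers\<close>).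

  A fixed variable has no such power with probability \<open>(1 - p)\<^sup>N \<le> exp (- p N)\<close>, because
  there are \<open>N\<close> independent candidates, and a union bound over the \<open>n\<close> variables
  gives \<open>prob_reg0_le\<close>. Since \<open>p r \<longlonglongrightarrow> \<infinity>\<close>, this failure probability vanishes. The count
  of candidates is only right while \<open>N \<le> D\<close>; once \<open>r \<ge> D\<close> the claim is
  deterministic, as minimal generators are members of the random set and have degree at
  most \<open>D\<close>.

  The algebra rests on the fact that a monomial lies in a monomial ideal only if it is a
  multiple of one of the generating monomials (\<open>monomial_in_ideal\<close>).
\<close>

section \<open>Divisibility of monomials and membership in monomial ideals\<close>

abbreviation monomial :: "('n::finite \<Rightarrow>\<^sub>0 nat) \<Rightarrow> ('n, 'k::field) mpoly" where
  "monomial m \<equiv> Poly_Mapping.single m 1"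

lemma monomial_in_monomials: "monomial m \<in> monomials"
  by (auto simp: monomials_def)

lemma monomial_dvd_monomial_iff:
  "(monomial a :: ('n::finite, 'k::field) mpoly) dvd monomial b \<longleftrightarrow> (\<exists>c. b = a + c)"
proof
  assume "(monomial a :: ('n, 'k) mpoly) dvd monomial b"
  then obtain f :: "('n, 'k) mpoly" where "monomial b = monomial a * f" by (elim dvdE)
  then have "b \<in> Poly_Mapping.keys (monomial a * f)" by (metis keys_single one_neq_zero singletonI)
  with keys_mult[of "monomial a" f] show "\<exists>c. b = a + c" by auto
next
  assume "\<exists>c. b = a + c"
  then obtain c where "b = a + c" ..
  then have "(monomial b :: ('n, 'k) mpoly) = monomial a * monomial c" by (simp add: mult_single)
  then show "(monomial a :: ('n, 'k) mpoly) dvd monomial b" by simp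
qed

lemma lookup_le_if_monomial_dvd:
  "(monomial a :: ('n::finite, 'k::field) mpoly) dvd monomial b \<Longrightarrow>
    Poly_Mapping.lookup a i \<le> Poly_Mapping.lookup b i"
  by (auto simp: monomial_dvd_monomial_iff lookup_add)

lemma monomials_dvd_antisym:
  fixes x y :: "('n::finite, 'k::field) mpoly"
  assumes "x \<in> monomials" "y \<in> monomials" "x dvd y" "y dvd x"
  shows "x = y"
proof -
  obtain a b where "x = monomial a" "y = monomial b" using assms by (auto simp: monomials_def)
  moreover from this assms have "a = b"
    by (intro poly_mapping_eqI antisym) (auto dest: lookup_le_if_monomial_dvd)
  ultimately show ?thesis by simp
qed

lemma pure_power_dvd:
  assumes "k \<le> Poly_Mapping.lookup m i"
  shows "(monomial (Poly_Mapping.single i k) :: ('n::finite, 'k::field) mpoly) dvd monomial m"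
proof -
  have "m = Poly_Mapping.single i k + (m - Poly_Mapping.single i k)"
    using assms by (intro poly_mapping_eqI) (auto simp: lookup_add lookup_minus lookup_single when_def)
  then show ?thesis unfolding monomial_dvd_monomial_iff ..
qed

lemma ideal_base: "x \<in> B \<Longrightarrow> x \<in> ideal B"
  unfolding ideal_def by (rule module.span_base[OF module_mult])

lemma ideal_dvd: "x \<in> ideal B \<Longrightarrow> x dvd y \<Longrightarrow> y \<in> ideal B"
  unfolding ideal_def by (metis dvdE mult.commute module.span_scale[OF module_mult])

lemma ideal_eqI:
  assumes "A \<subseteq> ideal B" "B \<subseteq> ideal A"
  shows "ideal A = ideal B"
  using assms unfolding ideal_def by (simp add: module.span_eq[OF module_mult])

text \<open>
  The polynomials all of whose terms are multiples of members of \<open>B\<close> form an ideal, which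
  contains \<open>B\<close> and so also the ideal generated by \<open>B\<close>.
\<close>

lemma monomial_in_ideal:
  fixes B :: "('n::finite, 'k::field) mpoly set"
  assumes "B \<subseteq> monomials" "x \<in> monomials" "x \<in> ideal B"
  obtains b where "b \<in> B" "b dvd x"
proof -
  define T :: "('n, 'k) mpoly set"
    where "T = {f. \<forall>m\<in>Poly_Mapping.keys f. \<exists>b\<in>B. b dvd monomial m}"
  have "module.subspace (*) T"
  proof (rule module.subspaceI[OF module_mult])
    show "0 \<in> T" by (simp add: T_def)
    show "f + g \<in> T" if "f \<in> T" "g \<in> T" for f g
      using that keys_add[of f g] by (auto simp: T_def)
    show "c * f \<in> T" if "f \<in> T" for c f
      unfolding T_def
    proof (intro CollectI ballI)
      fix m assume "m \<in> Poly_Mapping.keys (c * f)"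
      with keys_mult[of c f] obtain u v where m: "m = v + u" and v: "v \<in> Poly_Mapping.keys f"
        by (auto simp: add.commute)
      from v that obtain b where b: "b \<in> B" "b dvd monomial v" by (auto simp: T_def)
      have "(monomial v :: ('n, 'k) mpoly) dvd monomial m" using m monomial_dvd_monomial_iff by blast
      with b show "\<exists>b\<in>B. b dvd monomial m" by (blast intro: dvd_trans)
    qed
  qed
  moreover have "B \<subseteq> T"
  proof
    fix b assume b_in: "b \<in> B"
    with assms(1) obtain m where b: "b = monomial m" by (auto simp: monomials_def)
    have "\<exists>b'\<in>B. b' dvd monomial m"
      by (rule bexI[where x = b]) (simp_all add: b_in flip: b)
    with b show "b \<in> T" by (simp add: T_def)
  qed
  ultimately have "ideal B \<subseteq> T"
    unfolding ideal_def by (intro module.span_minimal[OF module_mult])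
  with assms(3) have "x \<in> T" by blast
  with assms(2) have "\<exists>b\<in>B. b dvd x" by (auto simp: T_def monomials_def)
  with that show thesis by blast
qed

section \<open>Minimal generators\<close>

text \<open>
  A minimal generator \<open>x\<close> is minimal for divisibility among all monomials of the ideal: a
  monomial \<open>y\<close> of the ideal dividing \<open>x\<close> is a multiple of some generator, and a generator
  other than \<open>x\<close> that divides \<open>x\<close> would make \<open>x\<close> redundant.
\<close>

lemma min_generating_set_dvd_eq:
  fixes G :: "('n::finite, 'k::field) mpoly set"
  assumes G: "min_generating_set I G" and x: "x \<in> G"
    and y: "y \<in> monomials" "y \<in> I" "y dvd x"
  shows "y = x"
proof -
  have Gm: "G \<subseteq> monomials" and GI: "ideal G = I"
    and min: "\<And>H. H \<subset> G \<Longrightarrow> ideal H \<noteq> I"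
    using G by (auto simp: min_generating_set_def)
  obtain g where g: "g \<in> G" "g dvd y" using monomial_in_ideal Gm GI y by blast
  have "g = x"
  proof (rule ccontr)
    assume "g \<noteq> x"
    then have "g \<in> ideal (G - {x})" using g by (auto intro: ideal_base)
    then have "x \<in> ideal (G - {x})" using g y by (meson ideal_dvd dvd_trans)
    then have "ideal (G - {x}) = ideal G" by (intro ideal_eqI) (auto intro: ideal_base)
    with min[of "G - {x}"] x GI show False by blast
  qed
  with g y x Gm show ?thesis by (blast intro: monomials_dvd_antisym)
qed

text \<open>
  A minimal generator is a multiple of some member of \<open>B\<close>, which lies in the ideal and so
  equals it by minimality.
\<close>

lemma min_generators_ideal_subset:
  fixes B :: "('n::finite, 'k::field) mpoly set"
  assumes B: "B \<subseteq> monomials"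
  shows "min_generators (ideal B) \<subseteq> B"
proof
  fix x assume "x \<in> min_generators (ideal B)"
  then obtain G where G: "min_generating_set (ideal B) G" "x \<in> G"
    by (auto simp: min_generators_def)
  then have "x \<in> monomials" "x \<in> ideal B"
    by (auto simp: min_generating_set_def intro: ideal_base)
  then obtain b where "b \<in> B" "b dvd x" using monomial_in_ideal B by blast
  moreover from this have "b = x"
    using B by (intro min_generating_set_dvd_eq[OF G]) (auto intro: ideal_base)
  ultimately show "x \<in> B" by simp
qed

lemma exists_min_generating_set:
  fixes B :: "('n::finite, 'k::field) mpoly set"
  assumes B: "B \<subseteq> monomials" and fin: "finite B"
  obtains G where "min_generating_set (ideal B) G"
proof -
  define \<G> where "\<G> = {G. G \<subseteq> B \<and> ideal G = ideal B}"
  have "finite \<G>" using fin by (auto simp: \<G>_def intro: finite_subset[of _ "Pow B"])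
  moreover have "B \<in> \<G>" by (simp add: \<G>_def)
  ultimately obtain G where "G \<in> \<G>" "\<And>H. H \<in> \<G> \<Longrightarrow> H \<subseteq> G \<Longrightarrow> G = H"
    using finite_has_minimal[of \<G>] by auto
  then have "min_generating_set (ideal B) G"
    using B unfolding min_generating_set_def \<G>_def by blast
  with that show thesis .
qed

text \<open>
  \<^const>\<open>reg0\<close> is a \<^const>\<open>Max\<close>, so a bound on every minimal generator bounds it only once the
  set of minimal generators is known to be finite and, for a nonzero ideal, nonempty.
\<close>

lemma reg0_ideal_leI:
  fixes B :: "('n::finite, 'k::field) mpoly set"
  assumes B: "B \<subseteq> monomials" "finite B"
    and le: "\<And>x. x \<in> min_generators (ideal B) \<Longrightarrow> total_degree x \<le> d"
  shows "reg0 (ideal B) \<le> d"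
proof (cases "ideal B = {0}")
  case False
  obtain G where G: "min_generating_set (ideal B) G" using exists_min_generating_set B by blast
  with False have "G \<noteq> {}" by (auto simp: min_generating_set_def ideal_empty)
  with G have "min_generators (ideal B) \<noteq> {}" by (auto simp: min_generators_def)
  moreover have "finite (min_generators (ideal B))"
    using min_generators_ideal_subset B finite_subset by blast
  ultimately show ?thesis using False le by (simp add: reg0_def)
qed (simp add: reg0_def)

lemma reg0_ideal_le_bound:
  fixes B :: "('n::finite, 'k::field) mpoly set"
  assumes "B \<subseteq> nonconst_monomials_upto D"
  shows "reg0 (ideal B) \<le> D"
proof -
  have B: "B \<subseteq> monomials" using assms by (auto simp: nonconst_monomials_upto_def)
  show ?thesis
    using B assms min_generators_ideal_subset[OF B]
    by (intro reg0_ideal_leI finite_subset[OF assms finite_nonconst_monomials_upto])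
      (auto simp: nonconst_monomials_upto_def)
qed

definition pure_powers :: "nat \<Rightarrow> 'n::finite \<Rightarrow> ('n, 'k::field) mpoly set" where
  "pure_powers N i = (\<lambda>a. monomial (Poly_Mapping.single i a)) ` {1..N}"

lemma card_pure_powers:
  "card (pure_powers N i :: ('n::finite, 'k::field) mpoly set) = N"
proof -
  have "inj (\<lambda>a. monomial (Poly_Mapping.single i a) :: ('n, 'k) mpoly)"
    by (rule injI) (metis keys_single one_neq_zero singleton_inject lookup_single_eq)
  then show ?thesis unfolding pure_powers_def by (subst card_image) (auto intro: inj_on_subset)
qed

lemma exp_degree_single: "exp_degree (Poly_Mapping.single i a) = a"
  by (simp add: exp_degree_def lookup_single when_def)

lemma pure_powers_subset_nonconst_monomials_upto:
  "N \<le> D \<Longrightarrow> pure_powers N i \<subseteq> nonconst_monomials_upto D"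
  by (auto simp: pure_powers_def nonconst_monomials_upto_def monomial_in_monomials
      total_degree_single exp_degree_single)

text \<open>
  A minimal generator in which \<open>x\<^sub>i\<close> had an exponent above \<open>N\<close> would be divisible by
  the power \<open>x\<^sub>i\<^sup>a\<close> in the ideal, hence equal to it by minimality, although
  \<open>a \<le> N\<close>. So all \<open>n\<close> exponents are at most \<open>N\<close>.
\<close>

lemma reg0_le_if_pure_powers:
  fixes B :: "('n::finite, 'k::field) mpoly set"
  assumes B: "B \<subseteq> monomials" "finite B"
    and pure: "\<And>i. pure_powers N i \<inter> B \<noteq> {}"
  shows "reg0 (ideal B) \<le> CARD('n) * N"
proof (rule reg0_ideal_leI[OF B])
  fix x assume "x \<in> min_generators (ideal B)"
  then obtain G where G: "min_generating_set (ideal B) G" "x \<in> G"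
    by (auto simp: min_generators_def)
  then obtain m where x: "x = monomial m" by (auto simp: min_generating_set_def monomials_def)
  have "Poly_Mapping.lookup m i \<le> N" for i
  proof (rule ccontr)
    assume "\<not> Poly_Mapping.lookup m i \<le> N"
    moreover obtain a where a: "a \<le> N" "(monomial (Poly_Mapping.single i a) :: ('n, 'k) mpoly) \<in> B"
      using pure[of i] by (auto simp: pure_powers_def)
    ultimately have less: "a < Poly_Mapping.lookup m i" by simp
    then have "(monomial (Poly_Mapping.single i a) :: ('n, 'k) mpoly) dvd x"
      unfolding x by (intro pure_power_dvd) simp
    with a have eq: "monomial (Poly_Mapping.single i a) = x"
      by (intro min_generating_set_dvd_eq[OF G]) (auto simp: monomial_in_monomials intro: ideal_base)
    have "(monomial m :: ('n, 'k) mpoly) dvd monomial (Poly_Mapping.single i a)"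
      using eq x by simp
    then have "Poly_Mapping.lookup m i \<le> a" using lookup_le_if_monomial_dvd[of m _ i] by fastforce
    with less show False by simp
  qed
  then have "exp_degree m \<le> CARD('n) * N"
    unfolding exp_degree_def using sum_bounded_above[of UNIV "Poly_Mapping.lookup m" N] by simp
  then show "total_degree x \<le> CARD('n) * N" by (simp add: x total_degree_single)
qed

section \<open>The random set of monomials\<close>

lemma set_pmf_random_monomials:
  assumes "B \<in> set_pmf (random_monomials D p)"
  shows "B \<subseteq> nonconst_monomials_upto D"
  using assms by (auto simp: random_monomials_def)

lemma prob_random_monomials_disjoint:
  fixes A :: "('n::finite, 'k::field) mpoly set"
  assumes p: "0 \<le> p" "p \<le> 1" and A: "A \<subseteq> nonconst_monomials_upto D"
  shows "measure_pmf.prob (random_monomials D p) {B. A \<inter> B = {}} = (1 - p) ^ card A"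
proof -
  let ?X = "nonconst_monomials_upto D :: ('n, 'k) mpoly set"
  let ?C = "\<lambda>x. if x \<in> A then {False} else UNIV"
  have fin: "finite ?X" by (rule finite_nonconst_monomials_upto)
  have "(\<lambda>f. {x \<in> ?X. f x}) -` {B. A \<inter> B = {}} = Pi ?X ?C"
    using A by (auto simp: Pi_def)
  then have "measure_pmf.prob (random_monomials D p) {B. A \<inter> B = {}} =
      (\<Prod>x\<in>?X. measure_pmf.prob (bernoulli_pmf p) (?C x))"
    by (simp add: random_monomials_def measure_Pi_pmf_Pi[OF fin])
  also have "\<dots> = (\<Prod>x\<in>?X. if x \<in> A then 1 - p else 1)"
    using p by (intro prod.cong) (auto simp: measure_pmf_single)
  also have "\<dots> = (1 - p) ^ card A"
    using A fin by (simp add: prod.If_cases Int_absorb1)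
  finally show ?thesis .
qed

text \<open>
  Failure forces some variable to have all \<open>N\<close> of its candidate pure powers missing; the
  union bound over the variables uses \<open>1 - p \<le> exp (- p)\<close>.
\<close>

lemma prob_reg0_le:
  assumes p: "0 \<le> p" "p \<le> 1" and N: "N \<le> D"
  shows "1 - real CARD('n) * exp (- (p * real N)) \<le>
    measure_pmf.prob (random_monomial_ideal D p :: ('n::finite, 'k::field) mpoly set pmf)
      {I. reg0 I \<le> CARD('n) * N}"
proof -
  let ?M = "random_monomials D p :: ('n, 'k) mpoly set pmf"
  let ?miss = "\<lambda>i. {B. pure_powers N i \<inter> B = {}} :: ('n, 'k) mpoly set set"
  let ?good = "{I :: ('n, 'k) mpoly set. reg0 I \<le> CARD('n) * N}"
  have miss: "measure_pmf.prob ?M (?miss i) \<le> exp (- (p * real N))" for i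
  proof -
    have "measure_pmf.prob ?M (?miss i) = (1 - p) ^ N"
      using prob_random_monomials_disjoint[OF p pure_powers_subset_nonconst_monomials_upto[OF N, of i]]
      by (simp add: card_pure_powers)
    also have "\<dots> \<le> exp (- p) ^ N"
      using p exp_ge_add_one_self[of "- p"] by (intro power_mono) auto
    also have "\<dots> = exp (- (p * real N))"
      by (simp add: exp_of_nat_mult[symmetric] mult.commute)
    finally show ?thesis .
  qed
  have "measure_pmf.prob ?M (- (ideal -` ?good)) \<le> measure_pmf.prob ?M (\<Union>i. ?miss i)"
  proof (rule measure_pmf.finite_measure_mono_AE)
    show "AE B in measure_pmf ?M. B \<in> - (ideal -` ?good) \<longrightarrow> B \<in> (\<Union>i. ?miss i)"
    proof (rule AE_pmfI, rule impI, rule ccontr)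
      fix B assume "B \<in> set_pmf ?M" and bad: "B \<in> - (ideal -` ?good)" and "B \<notin> (\<Union>i. ?miss i)"
      then have B: "B \<subseteq> nonconst_monomials_upto D" "\<And>i. pure_powers N i \<inter> B \<noteq> {}"
        by (auto dest: set_pmf_random_monomials)
      moreover have "finite B" "B \<subseteq> monomials"
        using finite_subset[OF B(1) finite_nonconst_monomials_upto] B(1)
        by (simp, auto simp: nonconst_monomials_upto_def)
      ultimately have "reg0 (ideal B) \<le> CARD('n) * N" by (intro reg0_le_if_pure_powers)
      with bad show False by simp
    qed
  qed simp
  also have "\<dots> \<le> (\<Sum>i\<in>UNIV. measure_pmf.prob ?M (?miss i))"
    by (intro measure_pmf.finite_measure_subadditive_finite) auto
  also have "\<dots> \<le> real CARD('n) * exp (- (p * real N))"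
    using sum_bounded_above[of UNIV "\<lambda>i. measure_pmf.prob ?M (?miss i)"] miss by simp
  finally show ?thesis
    using measure_pmf.prob_compl[of "ideal -` ?good" ?M]
    by (simp add: random_monomial_ideal_def Compl_eq_Diff_UNIV)
qed

lemma prob_reg0_le_eq_1:
  assumes "real D \<le> t"
  shows "measure_pmf.prob (random_monomial_ideal D p :: ('n::finite, 'k::field) mpoly set pmf)
    {I. real (reg0 I) \<le> t} = 1"
proof -
  have "AE I in measure_pmf (random_monomial_ideal D p :: ('n, 'k) mpoly set pmf).
      I \<in> {I. real (reg0 I) \<le> t}"
  proof (rule AE_pmfI)
    fix I :: "('n, 'k) mpoly set"
    assume "I \<in> set_pmf (random_monomial_ideal D p)"
    then obtain B where "I = ideal B" "B \<in> set_pmf (random_monomials D p)"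
      by (auto simp: random_monomial_ideal_def)
    then have "reg0 I \<le> D" using reg0_ideal_le_bound set_pmf_random_monomials by blast
    with assms show "I \<in> {I. real (reg0 I) \<le> t}" by simp
  qed
  then show ?thesis by (simp add: measure_pmf.prob_eq_1)
qed


section \<open>The asymptotic bound\<close>

theorem theorem4p7:
  fixes p r :: "nat \<Rightarrow> real"
  assumes p01: "\<And>D. 0 \<le> p D \<and> p D \<le> 1"
    and r_pos: "\<And>D. 0 < r D"
    and r_lim: "filterlim r at_top at_top"
    and p_omega: "p \<in> \<omega>(\<lambda>D. 1 / r D)"
  shows "(\<lambda>D. measure_pmf.prob
            (random_monomial_ideal D (p D) :: ('n::finite, 'k::field) mpoly set pmf)
            {I. real (reg0 I) \<le> real CARD('n) * r D}) \<longlonglongrightarrow> 1"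
proof -
  let ?P = "\<lambda>D. measure_pmf.prob
            (random_monomial_ideal D (p D) :: ('n, 'k) mpoly set pmf)
            {I. real (reg0 I) \<le> real CARD('n) * r D}"
  have pr: "filterlim (\<lambda>D. p D * r D) at_top at_top"
    unfolding filterlim_at_top_gt[where c = 0]
  proof (intro allI impI)
    fix c :: real assume "0 < c"
    then have "eventually (\<lambda>D. c * norm (1 / r D) \<le> norm (p D)) at_top"
      using p_omega by (auto dest: landau_omega.smallD)
    then show "eventually (\<lambda>D. c \<le> p D * r D) at_top"
    proof eventually_elim
      case (elim D)
      then show ?case using p01[of D] r_pos[of D] by (simp add: field_simps)
    qed
  qed
  \<comment> \<open>Rounding \<open>r\<close> down costs a term \<open>p \<le> 1\<close> in the exponent.\<close>
  have lower: "1 - real CARD('n) * exp (1 - p D * r D) \<le> ?P D" for D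
  proof (cases "real D \<le> r D")
    case True
    have "r D \<le> real CARD('n) * r D" using r_pos[of D] by (simp add: Suc_leI)
    with True have "?P D = 1" by (intro prob_reg0_le_eq_1) simp
    then show ?thesis by simp
  next
    case False
    define N where "N = nat \<lfloor>r D\<rfloor>"
    have N: "real N \<le> r D" "r D \<le> real N + 1"
      using r_pos[of D] by (simp_all add: N_def)
    have "N \<le> D" using N False by linarith
    have "p D * r D \<le> p D * (real N + 1)" using N p01[of D] by (intro mult_left_mono) auto
    also have "\<dots> \<le> p D * real N + 1" using p01[of D] by (simp add: algebra_simps)
    finally have "exp (- (p D * real N)) \<le> exp (1 - p D * r D)" by simp
    then have "1 - real CARD('n) * exp (1 - p D * r D) \<le>
        1 - real CARD('n) * exp (- (p D * real N))"
      by (simp add: mult_left_mono)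
    also have "\<dots> \<le> measure_pmf.prob (random_monomial_ideal D (p D) :: ('n, 'k) mpoly set pmf)
        {I. reg0 I \<le> CARD('n) * N}"
      using p01[of D] \<open>N \<le> D\<close> by (intro prob_reg0_le) auto
    also have "\<dots> \<le> ?P D"
    proof (rule measure_pmf.finite_measure_mono)
      have "real d \<le> real CARD('n) * r D" if "d \<le> CARD('n) * N" for d
      proof -
        have "real d \<le> real (CARD('n) * N)" using that by (rule of_nat_mono)
        also have "\<dots> \<le> real CARD('n) * r D" using N by (simp add: mult_left_mono)
        finally show ?thesis .
      qed
      then show "{I :: ('n, 'k) mpoly set. reg0 I \<le> CARD('n) * N} \<subseteq>
          {I. real (reg0 I) \<le> real CARD('n) * r D}"
        by blast
    qed simp
    finally show ?thesis .
  qed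
  have "filterlim (\<lambda>D. - 1 + p D * r D) at_top at_top"
    by (rule filterlim_tendsto_add_at_top[OF tendsto_const pr])
  then have "filterlim (\<lambda>D. - (- 1 + p D * r D)) at_bot at_top"
    by (rule filterlim_uminus_at_top[THEN iffD1])
  then have "filterlim (\<lambda>D. 1 - p D * r D) at_bot at_top" by simp
  then have "(\<lambda>D. exp (1 - p D * r D)) \<longlonglongrightarrow> 0"
    by (rule filterlim_compose[OF exp_at_bot])
  then have "(\<lambda>D. 1 - real CARD('n) * exp (1 - p D * r D)) \<longlonglongrightarrow> 1 - real CARD('n) * 0"
    by (intro tendsto_intros)
  then have "(\<lambda>D. 1 - real CARD('n) * exp (1 - p D * r D)) \<longlonglongrightarrow> 1" by simp
  then show ?thesis
    by (rule tendsto_sandwich[rotated 2, OF _ tendsto_const])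
      (use lower in \<open>simp_all add: always_eventually\<close>)
qed

end
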